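(* Let $S$ be a symmetric (respectively, pseudo-symmetric) numerical semigroup with set of gaps $G$ and Frobenius number $F$, and let $P(z)$ be a gap polynomial (respectively, a pseudo-gap polynomial) of $S$, with complex coefficients. Let $r_1, r_2, \ldots, r_{F-1} \in \mathbb{C}$ be the $F-1$ critical points of $P$ (the roots of $P'$), counted with multiplicity, and for each positive integer $k$ let $p_k = r_1^k + r_2^k + \cdots + r_{F-1}^k$. Then $p_g = 0$ for every gap $g \in G$.
   Context: A numerical semigroup $S$ is a set of non-negative integers that is closed under addition and contains $0$ and all but finitely many natural numbers. Its set of gaps $G$ is the (finite) set of non-negative integers not in $S$; $G$ is assumed nonempty, and the Frobenius number $F$ is the largest gap. $S$ is symmetric if $i \in G$ implies $F - i \in S$ (this forces $F$ to be odd). $S$ is pseudo-symmetric if $F$ is even and $i \in G$, $i \neq F/2$ implies $F - i \in S$. If $F$ is odd, a gap polynomial of $S$ is a polynomial of the form $P(z) = \sum_{g \in G} c_g z^g$ with $c_F \neq 0$. If $F$ is even, a pseudo-gap polynomial of $S$ is a polynomial of the form $P(z) = \sum_{g \in G,\, g \neq F/2} c_g z^g$ with $c_F \neq 0$. The coefficients $c_g$ are complex numbers. *)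

theory Defs
  imports "HOL-Computational_Algebra.Computational_Algebra"
begin

definition gaps :: "nat set \<Rightarrow> nat set" where
  "gaps S = {n. n \<notin> S}"

(* The last conjunct records the standing assumption that S is a proper subset of the
   natural numbers, so that the Frobenius number exists. *)
definition numerical_semigroup :: "nat set \<Rightarrow> bool" where
  "numerical_semigroup S \<longleftrightarrow>
     0 \<in> S \<and> (\<forall>x\<in>S. \<forall>y\<in>S. x + y \<in> S) \<and> finite (gaps S) \<and> gaps S \<noteq> {}"

definition frobenius_number :: "nat set \<Rightarrow> nat" where
  "frobenius_number S = Max (gaps S)"

(* Subtraction does not truncate in the next two definitions, as every gap is at most the
   Frobenius number. *)
definition symmetric_semigroup :: "nat set \<Rightarrow> bool" where
  "symmetric_semigroup S \<longleftrightarrow>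
     numerical_semigroup S \<and> (\<forall>i\<in>gaps S. frobenius_number S - i \<in> S)"

definition pseudo_symmetric_semigroup :: "nat set \<Rightarrow> bool" where
  "pseudo_symmetric_semigroup S \<longleftrightarrow>
     numerical_semigroup S \<and> even (frobenius_number S) \<and>
     (\<forall>i\<in>gaps S. i \<noteq> frobenius_number S div 2 \<longrightarrow> frobenius_number S - i \<in> S)"

definition gap_polynomial :: "nat set \<Rightarrow> complex poly \<Rightarrow> bool" where
  "gap_polynomial S P \<longleftrightarrow> odd (frobenius_number S) \<and>
     (\<exists>c. c (frobenius_number S) \<noteq> 0 \<and> P = (\<Sum>g\<in>gaps S. monom (c g) g))"

definition pseudo_gap_polynomial :: "nat set \<Rightarrow> complex poly \<Rightarrow> bool" where
  "pseudo_gap_polynomial S P \<longleftrightarrow> even (frobenius_number S) \<and>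
     (\<exists>c. c (frobenius_number S) \<noteq> 0 \<and>
        P = (\<Sum>g\<in>gaps S - {frobenius_number S div 2}. monom (c g) g))"

(* r 1, ..., r n is a complete list of the critical points of P, each repeated
   according to its multiplicity as a root of the derivative. *)
definition enumerates_critical_points :: "complex poly \<Rightarrow> nat \<Rightarrow> (nat \<Rightarrow> complex) \<Rightarrow> bool" where
  "enumerates_critical_points P n r \<longleftrightarrow>
     image_mset r (mset_set {1..n}) = proots (pderiv P)"

lemma frobenius_number_pos:
  assumes "numerical_semigroup S"
  shows "frobenius_number S \<in> gaps S" "0 < frobenius_number S"
proof -
  show *: "frobenius_number S \<in> gaps S"
    using assms by (auto simp: numerical_semigroup_def frobenius_number_def intro!: Max_in)
  show "0 < frobenius_number S"
    using * assms by (cases "frobenius_number S = 0") (auto simp: numerical_semigroup_def gaps_def)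
qed

lemma degree_sum_monom_gaps:
  fixes c :: "nat \<Rightarrow> complex"
  assumes S: "numerical_semigroup S" and A: "A \<subseteq> gaps S" "frobenius_number S \<in> A"
    and c: "c (frobenius_number S) \<noteq> 0"
  shows "degree (\<Sum>g\<in>A. monom (c g) g) = frobenius_number S"
proof (rule antisym)
  have fin: "finite (gaps S)" "finite A"
    using S A by (auto simp: numerical_semigroup_def intro: finite_subset)
  show "degree (\<Sum>g\<in>A. monom (c g) g) \<le> frobenius_number S"
  proof (rule degree_sum_le[OF fin(2)])
    fix g assume "g \<in> A"
    then have "g \<le> frobenius_number S"
      using A fin by (auto simp: frobenius_number_def)
    then show "degree (monom (c g) g) \<le> frobenius_number S"
      using degree_monom_le order.trans by blast
  qed
  have "coeff (\<Sum>g\<in>A. monom (c g) g) (frobenius_number S) = c (frobenius_number S)"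
    using A fin by (simp add: coeff_sum)
  then show "frobenius_number S \<le> degree (\<Sum>g\<in>A. monom (c g) g)"
    using c by (simp add: le_degree)
qed

lemma degree_gap_polynomial:
  assumes "symmetric_semigroup S \<and> gap_polynomial S P \<or>
           pseudo_symmetric_semigroup S \<and> pseudo_gap_polynomial S P"
  shows "degree P = frobenius_number S"
proof -
  have S: "numerical_semigroup S"
    using assms by (auto simp: symmetric_semigroup_def pseudo_symmetric_semigroup_def)
  note F = frobenius_number_pos[OF S]
  show ?thesis
    using assms F
    by (auto simp: gap_polynomial_def pseudo_gap_polynomial_def intro!: degree_sum_monom_gaps[OF S])
qed

(* There really are F - 1 critical points to enumerate. *)
lemma exists_critical_points_enumeration:
  assumes "symmetric_semigroup S \<and> gap_polynomial S P \<or>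
           pseudo_symmetric_semigroup S \<and> pseudo_gap_polynomial S P"
  shows "\<exists>r. enumerates_critical_points P (frobenius_number S - 1) r"
proof -
  obtain xs where xs: "mset xs = proots (pderiv P)"
    using ex_mset by blast
  have len: "length xs = frobenius_number S - 1"
    using arg_cong[OF xs, of size] degree_gap_polynomial[OF assms]
    by (simp add: size_proots_complex degree_pderiv)
  have "image_mset (\<lambda>i. xs ! (i - 1)) (mset_set {1..length xs}) =
        image_mset (\<lambda>i. xs ! i) (image_mset (\<lambda>i. i - 1) (mset_set {1..length xs}))"
    by (simp add: multiset.map_comp o_def)
  also have "image_mset (\<lambda>i. i - 1) (mset_set {1..length xs}) = mset_set {0..<length xs}"
  proof -
    have "bij_betw (\<lambda>i. i - 1) {1..length xs} {0..<length xs}"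
      by (rule bij_betw_byWitness[where f' = Suc]) auto
    then show ?thesis
      by (simp add: bij_betw_def image_mset_mset_set)
  qed
  also have "image_mset (\<lambda>i. xs ! i) (mset_set {0..<length xs}) = mset xs"
    by (metis map_nth mset_map mset_upt)
  finally show ?thesis
    using xs len unfolding enumerates_critical_points_def by metis
qed

end

theory Submission
  imports Defs
begin

text \<open>
  Up to a nonzero factor, the reversed polynomial of \<open>P'\<close> is
  \<open>Q(w) = (1 - r\<^sub>1 w) \<cdots> (1 - r\<^bsub>F-1\<^esub> w)\<close>, and its exponents are the numbers \<open>F - g\<close>, where \<open>g\<close>
  runs through the gaps that occur in \<open>P\<close>. Symmetry, or pseudo-symmetry together with the
  exclusion of \<open>F/2\<close>, says precisely that these exponents lie in \<open>S\<close>
  (\<open>coeff_reflect_pderiv_gap\<close>). As \<open>S\<close> is closed under addition, the power series with support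
  in \<open>S\<close> form a ring that contains the inverses of its members with nonzero constant term, and
  that is stable under \<open>w d/dw\<close>. It therefore contains \<open>w Q'/Q\<close>, which by logarithmic
  differentiation is \<open>- (p\<^sub>1 w + p\<^sub>2 w\<^sup>2 + \<cdots>)\<close> (\<open>fps_deriv_prod_linear\<close>). Hence \<open>p\<^sub>k = 0\<close> unless
  \<open>k \<in> S\<close>.

  The proof makes the ring argument elementary: comparing coefficients in \<open>Q' = - Q N\<close>, where
  \<open>N = p\<^sub>1 + p\<^sub>2 w + \<cdots>\<close>, gives Newton's identities, and these are solved for the power sums by
  strong induction (\<open>log_deriv_support\<close>).
\<close>

text \<open>
  Newton's identities in generating function form: each factor \<open>1 - r\<^sub>i X\<close> contributes
  \<open>- r\<^sub>i / (1 - r\<^sub>i X)\<close> to the logarithmic derivative, and this is a geometric series.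
\<close>
lemma fps_deriv_prod_linear:
  fixes r :: "'i \<Rightarrow> 'a::comm_ring_1"
  assumes "finite I"
  shows "fps_deriv (\<Prod>i\<in>I. 1 - fps_const (r i) * fps_X) =
         - ((\<Prod>i\<in>I. 1 - fps_const (r i) * fps_X) * Abs_fps (\<lambda>n. \<Sum>i\<in>I. r i ^ Suc n))"
  using assms
proof (induction I rule: finite_induct)
  case empty
  then show ?case by (simp add: fps_eq_iff)
next
  case (insert j I)
  define A B where "A = 1 - fps_const (r j) * fps_X"
    and "B = (\<Prod>i\<in>I. 1 - fps_const (r i) * fps_X)"
  define G N where "G = Abs_fps (\<lambda>n. r j ^ Suc n)"
    and "N = Abs_fps (\<lambda>n. \<Sum>i\<in>I. r i ^ Suc n)"
  have geometric: "A * G = fps_const (r j)"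
  proof (rule fps_ext)
    fix n
    show "(A * G) $ n = fps_const (r j) $ n"
      by (cases n) (simp_all add: A_def G_def left_diff_distrib mult.assoc)
  qed
  have "fps_deriv (A * B) = A * fps_deriv B + fps_deriv A * B"
    by simp
  also have "fps_deriv B = - (B * N)"
    using insert.IH by (simp add: B_def N_def)
  also have "fps_deriv A = - fps_const (r j)"
    by (simp add: A_def)
  also have "A * - (B * N) + - fps_const (r j) * B = - (A * B * (G + N))"
    unfolding geometric[symmetric] by (simp add: algebra_simps)
  also have "G + N = Abs_fps (\<lambda>n. \<Sum>i\<in>insert j I. r i ^ Suc n)"
    using insert.hyps by (simp add: G_def N_def fps_eq_iff)
  finally show ?case
    using insert.hyps by (simp add: A_def B_def)
qed

text \<open>
  In \<open>k f\<^sub>k = - (f\<^sub>0 n\<^sub>k + f\<^sub>1 n\<^bsub>k-1\<^esub> + \<cdots> + f\<^bsub>k-1\<^esub> n\<^sub>1)\<close>, where \<open>n\<^sub>i\<close> is the coefficient of \<open>N\<close> at \<open>i - 1\<close>, the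
  left side vanishes for \<open>k \<notin> S\<close>. So does each product \<open>f\<^sub>i n\<^bsub>k-i\<^esub>\<close> with \<open>0 < i < k\<close>, since \<open>i\<close> and
  \<open>k - i\<close> cannot both lie in \<open>S\<close>. What remains is \<open>f\<^sub>0 n\<^sub>k = 0\<close>.
\<close>
lemma log_deriv_support:
  fixes f N :: "'a::idom fps"
  assumes add: "\<And>x y. x \<in> S \<Longrightarrow> y \<in> S \<Longrightarrow> x + y \<in> S"
    and f0: "f $ 0 \<noteq> 0"
    and supp: "\<And>k. k \<notin> S \<Longrightarrow> k > 0 \<Longrightarrow> f $ k = 0"
    and deriv: "fps_deriv f = - (f * N)"
    and k: "k \<notin> S" "k > 0"
  shows "N $ (k - 1) = 0"
  using k
proof (induction k rule: less_induct)
  case (less k)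
  obtain m where m: "k = Suc m"
    using less.prems by (cases k) auto
  have "f $ i * N $ (m - i) = 0" if "i \<in> {1..m}" for i
  proof (cases "i \<in> S")
    case True
    then have "k - i \<notin> S"
      using add[of i "k - i"] that less.prems m by auto
    then show ?thesis
      using less.IH[of "k - i"] that m by auto
  next
    case False
    then show ?thesis
      using supp that by simp
  qed
  then have "(\<Sum>i = 1..m. f $ i * N $ (m - i)) = 0"
    by (intro sum.neutral) blast
  then have "(f * N) $ m = f $ 0 * N $ m"
    by (simp add: fps_mult_nth sum.atLeast_Suc_atMost)
  moreover have "(f * N) $ m = 0"
    using arg_cong[OF deriv, of "\<lambda>h. h $ m"] supp[of k] less.prems m by simp
  ultimately show ?case
    using f0 m by simp
qed

lemma reflect_pderiv_critical_points:
  assumes "enumerates_critical_points P n r"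
  shows "fps_of_poly (reflect_poly (pderiv P)) =
         fps_const (lead_coeff (pderiv P)) * (\<Prod>i = 1..n. 1 - fps_const (r i) * fps_X)"
proof -
  have "pderiv P = smult (lead_coeff (pderiv P)) (\<Prod>x\<in>#proots (pderiv P). [:-x, 1:])"
    by (rule complex_poly_decompose_multiset[symmetric])
  also have "proots (pderiv P) = image_mset r (mset_set {1..n})"
    using assms by (simp add: enumerates_critical_points_def)
  finally have "pderiv P = smult (lead_coeff (pderiv P)) (\<Prod>i = 1..n. [:- r i, 1:])"
    by (simp add: multiset.map_comp o_def prod_unfold_prod_mset)
  then have "reflect_poly (pderiv P) =
      smult (lead_coeff (pderiv P)) (\<Prod>i = 1..n. reflect_poly [:- r i, 1:])"
    by (metis reflect_poly_smult reflect_poly_prod)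
  moreover have "reflect_poly [:- x, 1:] = [:1, - x:]" for x :: complex
    by (rule poly_eqI) (auto simp: coeff_reflect_poly coeff_pCons split: nat.splits)
  moreover have "fps_of_poly [:1, - x:] = 1 - fps_const x * fps_X" for x :: complex
    by (simp add: fps_of_poly_linear' flip: fps_const_neg)
  ultimately show ?thesis
    by (simp only: fps_of_poly_smult fps_of_poly_prod)
qed

text \<open>
  The coefficient in question is \<open>F - k\<close> times the coefficient of \<open>P\<close> at \<open>F - k\<close>. If it were
  nonzero, then \<open>F - k\<close> would be a gap other than \<open>F/2\<close>, and symmetry would put
  \<open>F - (F - k) = k\<close> into \<open>S\<close>.
\<close>
lemma coeff_reflect_pderiv_gap:
  assumes P: "(symmetric_semigroup S \<and> gap_polynomial S P) \<or>
              (pseudo_symmetric_semigroup S \<and> pseudo_gap_polynomial S P)"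
    and k: "k \<in> gaps S"
  shows "coeff (reflect_poly (pderiv P)) k = 0"
proof (rule ccontr)
  define F where "F = frobenius_number S"
  assume nz: "coeff (reflect_poly (pderiv P)) k \<noteq> 0"
  have S: "numerical_semigroup S"
    using P by (auto simp: symmetric_semigroup_def pseudo_symmetric_semigroup_def)
  have F: "F > 0" and deg: "degree (pderiv P) = F - 1"
    using frobenius_number_pos[OF S] degree_gap_polynomial[OF P]
    by (simp_all add: F_def degree_pderiv)
  have fin: "finite (gaps S)"
    using S by (simp add: numerical_semigroup_def)
  have le: "k < F"
    using nz deg F by (auto simp: coeff_reflect_poly split: if_splits)
  then have "Suc (F - 1 - k) = F - k"
    by simp
  then have "coeff P (F - k) \<noteq> 0"
    using nz deg by (auto simp: coeff_reflect_poly coeff_pderiv split: if_splits)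
  then have "F - k \<in> gaps S \<and> (symmetric_semigroup S \<or> F - k \<noteq> F div 2)"
    using P fin
    by (auto simp: gap_polynomial_def pseudo_gap_polynomial_def coeff_sum F_def split: if_splits)
  then have "F - (F - k) \<in> S"
    using P by (auto simp: symmetric_semigroup_def pseudo_symmetric_semigroup_def F_def)
  then show False
    using le k by (simp add: gaps_def)
qed

theorem mainTheorem1:
  fixes S :: "nat set" and P :: "complex poly" and r p :: "nat \<Rightarrow> complex"
  assumes "(symmetric_semigroup S \<and> gap_polynomial S P) \<or>
           (pseudo_symmetric_semigroup S \<and> pseudo_gap_polynomial S P)"
    and "enumerates_critical_points P (frobenius_number S - 1) r"
    and "\<And>k. k > 0 \<Longrightarrow> p k = (\<Sum>i = 1..frobenius_number S - 1. r i ^ k)"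
  shows "\<forall>g\<in>gaps S. p g = 0"
proof
  fix g assume g: "g \<in> gaps S"
  define F where "F = frobenius_number S"
  define f where "f = fps_of_poly (reflect_poly (pderiv P))"
  define N where "N = Abs_fps (\<lambda>n. \<Sum>i = 1..F - 1. r i ^ Suc n)"
  have S: "numerical_semigroup S"
    using assms(1) by (auto simp: symmetric_semigroup_def pseudo_symmetric_semigroup_def)
  have g0: "g > 0"
    using S g by (cases "g = 0") (auto simp: numerical_semigroup_def gaps_def)
  have "pderiv P \<noteq> 0"
    using degree_gap_polynomial[OF assms(1)] frobenius_number_pos[OF S]
    by (simp add: pderiv_eq_0_iff)
  then have f0: "f $ 0 \<noteq> 0"
    by (simp add: f_def)
  have supp: "f $ k = 0" if "k \<notin> S" for k
    using coeff_reflect_pderiv_gap[OF assms(1), of k] that by (simp add: f_def gaps_def)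
  have deriv: "fps_deriv f = - (f * N)"
    using fps_deriv_prod_linear[of "{1..F - 1}" r]
    unfolding f_def N_def F_def reflect_pderiv_critical_points[OF assms(2)]
    by (simp add: mult.assoc)
  have "N $ (g - 1) = 0"
    by (rule log_deriv_support[where S = S, OF _ f0 supp deriv])
      (use S g g0 in \<open>auto simp: numerical_semigroup_def gaps_def\<close>)
  then show "p g = 0"
    using assms(3)[of g] g0 by (simp add: N_def F_def flip: power_Suc)
qed

end
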